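(* Let $A,B\in\mathbb{C}^{n\times n}$ with $B$ invertible. Suppose $B^{-1}A$ is diagonalizable with eigenvalues $\lambda_1,\dots,\lambda_n$ and invertible right eigenvector matrix $V$. For $0<\epsilon<\sigma_n(B)$ let $$r_\epsilon=\epsilon\,\kappa(V)\,\|B^{-1}\|_2\left(1+\frac{\epsilon\|B^{-1}\|_2+\|B^{-1}A\|_2}{1-\epsilon\|B^{-1}\|_2}\right)$$ and further set, for $1\le i\le n$, $$r_i=\begin{cases}\dfrac{1}{\|B\|_2}&\text{if }A=0,\\[2mm] \max\left\{\dfrac1{\|B\|_2},\dfrac{|\lambda_i|}{\|A\|_2}\right\}&\text{otherwise.}\end{cases}$$ Then $$\bigcup_{i=1}^n B_{\epsilon r_i}(\lambda_i)\subseteq\Lambda_\epsilon(A,B)\subseteq\bigcup_{i=1}^n B_{r_\epsilon}(\lambda_i).$$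
   Context: $\|\cdot\|_2$ is the spectral norm, $\sigma_n(B)$ is the smallest singular value of $B$, and $\kappa(V)=\|V\|_2\|V^{-1}\|_2$. $B_r(z)=\{w\in\mathbb{C}:|w-z|\le r\}$. For $\epsilon>0$ the $\epsilon$-pseudospectrum of the pencil $(A,B)$ is $$\Lambda_\epsilon(A,B)=\{z\in\mathbb{C}:\ \exists\,u\ne0\text{ with }(A+\Delta A)u=z(B+\Delta B)u\text{ for some }\|\Delta A\|_2,\|\Delta B\|_2\le\epsilon\}.$$ *)

theory Defs
  imports "HOL-Analysis.Analysis"
begin

text \<open>
  The norm on \<^typ>\<open>complex ^ 'n\<close> is the Euclidean one, so its operator norm is the spectral norm.
\<close>

definition spectral_norm :: "complex ^ 'n ^ 'm \<Rightarrow> real" where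
  "spectral_norm A = onorm (\<lambda>x. A *v x)"

definition adjoint_matrix :: "complex ^ 'n ^ 'm \<Rightarrow> complex ^ 'm ^ 'n" where
  "adjoint_matrix A = (\<chi> i j. cnj (A $ j $ i))"

definition diag_matrix :: "complex ^ 'n \<Rightarrow> complex ^ 'n ^ 'n" where
  "diag_matrix d = (\<chi> i j. if i = j then d $ i else 0)"

text \<open>
  The singular values of a square matrix \<open>B\<close> are the nonnegative square roots of the
  eigenvalues of \<open>B\<^sup>* B\<close>; in particular \<open>0\<close> is one of them when \<open>B\<close> is singular.  The set is
  finite and nonempty, so \<^const>\<open>Min\<close> is meaningful on it.
\<close>

definition singular_values :: "complex ^ 'n ^ 'n \<Rightarrow> real set" where
  "singular_values B =
     {s. 0 \<le> s \<and> (\<exists>v. v \<noteq> 0 \<and>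
        (adjoint_matrix B ** B) *v v = complex_of_real (s\<^sup>2) *s v)}"

definition smallest_singular_value :: "complex ^ 'n ^ 'n \<Rightarrow> real" where
  "smallest_singular_value B = Min (singular_values B)"

definition cond_number :: "complex ^ 'n ^ 'n \<Rightarrow> real" where
  "cond_number V = spectral_norm V * spectral_norm (matrix_inv V)"

definition pencil_pseudospectrum ::
  "real \<Rightarrow> complex ^ 'n ^ 'n \<Rightarrow> complex ^ 'n ^ 'n \<Rightarrow> complex set" where
  "pencil_pseudospectrum \<epsilon> A B =
     {z. \<exists>u \<Delta>A \<Delta>B. u \<noteq> 0 \<and> spectral_norm \<Delta>A \<le> \<epsilon> \<and> spectral_norm \<Delta>B \<le> \<epsilon> \<and>
        (A + \<Delta>A) *v u = z *s ((B + \<Delta>B) *v u)}"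

end

theory Submission
  imports Defs
begin

text \<open>
  If \<open>A u = \<lambda> B u\<close> then \<open>z\<close> is an eigenvalue of the pencil perturbed by \<open>\<Delta>A = (z - \<lambda>) B\<close>, and also, when
  \<open>\<lambda> \<noteq> 0\<close>, by \<open>\<Delta>A = ((z - \<lambda>) / \<lambda>) A\<close>; the cheaper of the two gives the inner disks with \<open>\<Delta>B = 0\<close>.
  For the outer disks put \<open>E = B\<^sup>-\<^sup>1 \<Delta>B\<close>, \<open>F = B\<^sup>-\<^sup>1 \<Delta>A\<close>, \<open>C = B\<^sup>-\<^sup>1 A\<close>.  Then \<open>(z - C) u = (F - z E) u\<close>, and the
  Bauer--Fike argument in the eigenbasis of \<open>C\<close> bounds the distance of \<open>z\<close> to the spectrum of \<open>C\<close> by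
  \<open>\<kappa>(V) \<eta> (1 + |z|)\<close> with \<open>\<eta> = \<epsilon> \<parallel>B\<^sup>-\<^sup>1\<parallel> < 1\<close>, while \<open>z (1 + E) u = (C + F) u\<close> gives
  \<open>|z| (1 - \<eta>) \<le> \<parallel>C\<parallel> + \<eta>\<close>.
\<close>

section \<open>Matrix action and the spectral norm\<close>

lemma norm_vector_smult: "norm (c *s x) = cmod c * norm x" for x :: "complex ^ 'n"
  by (simp add: norm_vec_def norm_mult L2_set_right_distrib)

lemma mat_mult_vec: "mat c *v x = c *s x" for x :: "'a::comm_semiring_1 ^ 'n"
  by (simp add: vec_eq_iff matrix_vector_mult_def mat_def if_distrib if_distribR cong: if_cong)

lemma diag_matrix_mult_vec: "(diag_matrix d *v x) $ i = d $ i * x $ i"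
  by (simp add: matrix_vector_mult_def diag_matrix_def if_distrib if_distribR cong: if_cong)

lemma matrix_inv_cancel:
  fixes A :: "'a::semiring_1 ^ 'n ^ 'n"
  assumes "invertible A"
  shows "A *v (matrix_inv A *v x) = x" "matrix_inv A *v (A *v x) = x"
proof -
  have "\<exists>A'. A ** A' = mat 1 \<and> A' ** A = mat 1"
    using assms by (auto simp: invertible_def)
  then have "A ** matrix_inv A = mat 1 \<and> matrix_inv A ** A = mat 1"
    unfolding matrix_inv_def by (rule someI_ex)
  then show "A *v (matrix_inv A *v x) = x" "matrix_inv A *v (A *v x) = x"
    by (simp_all add: matrix_vector_mul_assoc)
qed

lemma norm_mult_vec_le_spectral_norm:
  "norm (A *v x) \<le> spectral_norm A * norm x"
  unfolding spectral_norm_def by (rule onorm[OF matrix_vector_mul_bounded_linear])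

lemma spectral_norm_nonneg: "0 \<le> spectral_norm A"
  unfolding spectral_norm_def by (rule onorm_pos_le[OF matrix_vector_mul_bounded_linear])

lemma spectral_norm_bound:
  assumes "0 \<le> b" "\<And>x. norm (A *v x) \<le> b * norm x"
  shows "spectral_norm A \<le> b"
  unfolding spectral_norm_def using assms by (rule onorm_bound)

lemma spectral_norm_zero [simp]: "spectral_norm 0 = 0"
  by (simp add: spectral_norm_def onorm_zero)

lemma spectral_norm_pos:
  assumes "A \<noteq> 0"
  shows "0 < spectral_norm A"
proof -
  obtain x where "A *v x \<noteq> 0"
    using assms by (metis matrix_eq matrix_vector_mult_0)
  moreover from this have "x \<noteq> 0" by auto
  ultimately show ?thesis
    using norm_mult_vec_le_spectral_norm[of A x] spectral_norm_nonneg[of A]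
    by (cases "spectral_norm A = 0") auto
qed

lemma spectral_norm_mat_mult_le: "spectral_norm (mat c ** A) \<le> cmod c * spectral_norm A"
proof (rule spectral_norm_bound)
  show "norm ((mat c ** A) *v x) \<le> cmod c * spectral_norm A * norm x" for x
    using norm_mult_vec_le_spectral_norm[of A x]
    by (simp add: mat_mult_vec norm_vector_smult mult_left_mono mult.assoc
        flip: matrix_vector_mul_assoc)
qed (simp add: spectral_norm_nonneg)

section \<open>Adjoint and singular values\<close>

lemma inner_adjoint_matrix:
  "inner (A *v x) y = inner x (adjoint_matrix A *v y)"
proof -
  \<comment> \<open>\<open>inner\<close> is the real part of the Hermitian product, so a factor
    crosses it as its conjugate; hence the conjugate transpose.\<close>
  have move: "inner (a * b) c = inner b (cnj a * c)" for a b c :: complex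
    by (simp add: inner_complex_def algebra_simps)
  have "inner (A *v x) y = (\<Sum>i\<in>UNIV. \<Sum>j\<in>UNIV. inner (x $ j) (cnj (A $ i $ j) * y $ i))"
    by (simp add: inner_vec_def matrix_vector_mult_def inner_sum_left move)
  also have "\<dots> = inner x (adjoint_matrix A *v y)"
    by (subst sum.swap)
      (simp add: inner_vec_def matrix_vector_mult_def inner_sum_right adjoint_matrix_def)
  finally show ?thesis .
qed

lemma of_real_smult_eq_scaleR: "complex_of_real c *s v = c *\<^sub>R v"
  by (simp add: vec_eq_iff complex_eq_iff)

lemma matrix_vector_mult_scaleR_complex: "A *v (c *\<^sub>R x) = c *\<^sub>R (A *v x)" for x :: "complex ^ 'n"
  by (rule linear_scale[OF matrix_vector_mul_linear])

text \<open>Eigenvectors of \<open>B\<^sup>* B\<close> for distinct eigenvalues are orthogonal, hence independent.\<close>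

lemma finite_singular_values: "finite (singular_values B)"
proof -
  define G where "G = adjoint_matrix B ** B"
  have G_sym: "inner (G *v x) y = inner x (G *v y)" for x y
    unfolding G_def by (metis inner_adjoint_matrix inner_commute matrix_vector_mul_assoc)
  have "\<forall>s\<in>singular_values B. \<exists>v. v \<noteq> 0 \<and> G *v v = s\<^sup>2 *\<^sub>R v"
    by (auto simp: singular_values_def G_def of_real_smult_eq_scaleR simp del: of_real_power)
  then obtain v where v: "\<And>s. s \<in> singular_values B \<Longrightarrow> v s \<noteq> 0 \<and> G *v v s = s\<^sup>2 *\<^sub>R v s"
    by metis
  have orth: "inner (v s) (v t) = 0"
    if "s \<in> singular_values B" "t \<in> singular_values B" "s \<noteq> t" for s t
  proof -
    have "s\<^sup>2 * inner (v s) (v t) = t\<^sup>2 * inner (v s) (v t)"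
      using G_sym[of "v s" "v t"] v that by simp
    \<comment> \<open>Both are nonnegative, so squaring keeps them distinct.\<close>
    moreover have "s\<^sup>2 \<noteq> t\<^sup>2"
      using that by (simp add: singular_values_def)
    ultimately show ?thesis by simp
  qed
  \<comment> \<open>Two singular values sharing a chosen vector would make it orthogonal to itself.
    Injectivity carries finiteness back from the vectors to the singular values.\<close>
  have inj: "inj_on v (singular_values B)"
    by (rule inj_onI) (metis orth v inner_eq_zero_iff)
  have "pairwise orthogonal (v ` singular_values B)"
    unfolding pairwise_def orthogonal_def using orth by auto
  moreover have "0 \<notin> v ` singular_values B"
    using v by force
  ultimately have "independent (v ` singular_values B)"
    by (rule pairwise_orthogonal_independent)
  then have "finite (v ` singular_values B)"
    by (rule independent_imp_finite)
  then show ?thesis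
    using inj by (simp add: finite_image_iff)
qed

text \<open>
  The minimum \<open>m\<close> of \<open>\<parallel>B x\<parallel>\<close> over the unit sphere is attained, and the first-order condition at a
  minimiser is \<open>B\<^sup>* B v = m\<^sup>2 v\<close>; so \<open>m\<close> is itself a singular value.
\<close>

lemma smallest_singular_value_le:
  "smallest_singular_value B * norm x \<le> norm (B *v x)"
proof -
  have "continuous_on (sphere 0 1) (\<lambda>x. norm (B *v x))"
    by (intro continuous_intros)
  moreover have "sphere (0 :: complex ^ 'a) 1 \<noteq> {}"
    by simp
  ultimately obtain v where v: "norm v = 1"
    and vmin: "\<And>y. norm y = 1 \<Longrightarrow> norm (B *v v) \<le> norm (B *v y)"
    using continuous_attains_inf[of "sphere 0 1" "\<lambda>x. norm (B *v x)"] by auto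
  define m where "m = norm (B *v v)"
  have lower: "m * norm y \<le> norm (B *v y)" for y
  proof (cases "y = 0")
    case False
    then have "m \<le> norm (B *v ((1 / norm y) *\<^sub>R y))"
      unfolding m_def by (intro vmin) simp
    with False show ?thesis
      by (simp add: matrix_vector_mult_scaleR_complex field_simps)
  qed simp
  have expand: "(norm (a + t *\<^sub>R b))\<^sup>2 = (norm a)\<^sup>2 + 2 * t * inner a b + t\<^sup>2 * (norm b)\<^sup>2"
    for a b :: "complex ^ 'a" and t
    unfolding power2_norm_eq_inner
    by (simp add: inner_simps inner_commute power2_eq_square algebra_simps)
  \<comment> \<open>\<open>w\<close> is half the gradient of
    \<open>(norm (B *v x))\<^sup>2 - m\<^sup>2 * (norm x)\<^sup>2\<close> at \<open>v\<close>; the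
    aim is \<open>w = 0\<close>.\<close>
  define w where "w = (adjoint_matrix B ** B) *v v - m\<^sup>2 *\<^sub>R v"
  \<comment> \<open>That function is nonnegative by \<open>lower\<close> and vanishes at
    \<open>v\<close>; this is its expansion along \<open>v + t *\<^sub>R w\<close>.\<close>
  have quad: "0 \<le> 2 * t * inner w w + t\<^sup>2 * ((norm (B *v w))\<^sup>2 - m\<^sup>2 * (norm w)\<^sup>2)" for t
  proof -
    have "(m * norm (v + t *\<^sub>R w))\<^sup>2 \<le> (norm (B *v (v + t *\<^sub>R w)))\<^sup>2"
      using lower by (intro power_mono) (auto simp: m_def)
    then have le: "m\<^sup>2 * (1 + 2 * t * inner v w + t\<^sup>2 * (norm w)\<^sup>2)
        \<le> m\<^sup>2 + 2 * t * inner (B *v v) (B *v w) + t\<^sup>2 * (norm (B *v w))\<^sup>2"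
      unfolding matrix_vector_right_distrib matrix_vector_mult_scaleR_complex
        power_mult_distrib expand v m_def[symmetric] by simp
    have ww: "inner w w = inner (B *v v) (B *v w) - m\<^sup>2 * inner v w"
    proof -
      have "inner ((adjoint_matrix B ** B) *v v) w = inner (B *v v) (B *v w)"
        by (metis inner_adjoint_matrix inner_commute matrix_vector_mul_assoc)
      then show ?thesis
        by (subst (1) w_def) (simp add: inner_diff_left)
    qed
    show ?thesis
      using le unfolding ww by (simp add: algebra_simps)
  qed
  have "inner w w = 0"
  proof (rule ccontr)
    assume "inner w w \<noteq> 0"
    then have pos: "0 < inner w w"
      using inner_ge_zero[of w] by linarith
    \<comment> \<open>The summand 1 keeps \<open>K\<close> positive. With
      \<open>t = inner w w / K\<close> the quadratic term costs at most half of the linear gain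
      \<open>2 * t * inner w w\<close>.\<close>
    define K where "K = \<bar>(norm (B *v w))\<^sup>2 - m\<^sup>2 * (norm w)\<^sup>2\<bar> + 1"
    have K: "0 < K" by (simp add: K_def add_nonneg_pos)
    define t where "t = inner w w / K"
    have "0 < t" using pos K by (simp add: t_def)
    have "0 \<le> - 2 * t * inner w w + t\<^sup>2 * ((norm (B *v w))\<^sup>2 - m\<^sup>2 * (norm w)\<^sup>2)"
      using quad[of "- t"] by simp
    also have "\<dots> \<le> - 2 * t * inner w w + t\<^sup>2 * K"
      by (intro add_left_mono mult_left_mono) (auto simp: K_def)
    also have "\<dots> = - (t * inner w w)"
      using K by (simp add: t_def power2_eq_square)
    finally show False
      using mult_pos_pos[OF \<open>0 < t\<close> pos] by linarith
  qed
  then have "(adjoint_matrix B ** B) *v v = m\<^sup>2 *\<^sub>R v"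
    by (simp add: w_def)
  moreover have "v \<noteq> 0" using v by auto
  ultimately have "m \<in> singular_values B"
    unfolding singular_values_def
    by (auto simp: m_def of_real_smult_eq_scaleR simp del: of_real_power)
  then have "smallest_singular_value B \<le> m"
    unfolding smallest_singular_value_def by (intro Min_le finite_singular_values)
  then have "smallest_singular_value B * norm x \<le> m * norm x"
    by (rule mult_right_mono) simp
  with lower[of x] show ?thesis by linarith
qed

text \<open>The lower bound on \<open>norm (B *v y)\<close> at \<open>y = matrix_inv B *v x\<close>
  bounds the inverse by \<open>1 / smallest_singular_value B\<close>. This makes the denominator in
  \<open>r\<^sub>\<epsilon>\<close> positive.\<close>

lemma spectral_norm_matrix_inv_less:
  assumes "invertible B" "0 < \<epsilon>" "\<epsilon> < smallest_singular_value B"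
  shows "\<epsilon> * spectral_norm (matrix_inv B) < 1"
proof -
  let ?s = "smallest_singular_value B"
  have s: "0 < ?s" using assms by linarith
  have "spectral_norm (matrix_inv B) \<le> 1 / ?s"
  proof (rule spectral_norm_bound)
    show "norm (matrix_inv B *v x) \<le> 1 / ?s * norm x" for x
      using smallest_singular_value_le[of B "matrix_inv B *v x"] s
      by (simp add: matrix_inv_cancel[OF assms(1)] field_simps)
  qed (use s in simp)
  then have "\<epsilon> * spectral_norm (matrix_inv B) \<le> \<epsilon> * (1 / ?s)"
    using assms by (intro mult_left_mono) auto
  also have "\<dots> < 1" using assms s by (simp add: field_simps)
  finally show ?thesis .
qed

section \<open>The Bauer--Fike bound\<close>

lemma norm_diag_matrix_ge:
  assumes "0 \<le> m" "\<And>i. m \<le> cmod (d $ i)"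
  shows "m * norm x \<le> norm (diag_matrix d *v x)"
proof -
  have "m * norm x = L2_set (\<lambda>i. m * norm (x $ i)) UNIV"
    by (simp add: norm_vec_def L2_set_right_distrib assms(1))
  also have "\<dots> \<le> L2_set (\<lambda>i. norm ((diag_matrix d *v x) $ i)) UNIV"
    by (intro L2_set_mono)
      (auto simp: diag_matrix_mult_vec norm_mult assms intro: mult_right_mono)
  finally show ?thesis by (simp add: norm_vec_def)
qed

text \<open>In the coordinates \<open>w\<close> of \<open>u\<close> with respect to the columns of
  \<open>V\<close>, \<open>z - C\<close> acts diagonally and multiplies norms by at least the
  distance from \<open>z\<close> to the nearest \<open>lam $ i\<close>; passing to \<open>w\<close>
  and back costs \<open>cond_number V\<close>. Nothing is divided by that distance, so
  \<open>z\<close> may itself be an eigenvalue.\<close>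

lemma bauer_fike:
  assumes V: "invertible V" and C: "C = V ** diag_matrix lam ** matrix_inv V"
    and "u \<noteq> 0" and resid: "norm (z *s u - C *v u) \<le> b * norm u"
  shows "\<exists>i. cmod (z - lam $ i) \<le> cond_number V * b"
proof -
  let ?S = "range (\<lambda>i. cmod (z - lam $ i))"
  define w where "w = matrix_inv V *v u"
  have u: "u = V *v w"
    by (simp add: w_def matrix_inv_cancel[OF V])
  have "w \<noteq> 0" using \<open>u \<noteq> 0\<close> u by auto
  have "Min ?S \<in> ?S" by (rule Min_in) auto
  then obtain i where i: "Min ?S = cmod (z - lam $ i)" by (rule rangeE)
  have "diag_matrix (\<chi> j. z - lam $ j) *v w = z *s w - diag_matrix lam *v w"
    by (simp add: vec_eq_iff diag_matrix_mult_vec algebra_simps)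
  also have "\<dots> = matrix_inv V *v (z *s u - C *v u)"
    by (simp add: C u matrix_inv_cancel[OF V] matrix_vector_mult_diff_distrib
        vector_scalar_commute flip: matrix_vector_mul_assoc)
  finally have eq: "diag_matrix (\<chi> j. z - lam $ j) *v w = matrix_inv V *v (z *s u - C *v u)" .
  \<comment> \<open>Nonnegativity of \<open>b\<close> comes from the residual bound, as
    \<open>u\<close> is nonzero.\<close>
  have "b * norm u \<ge> 0" using resid norm_ge_zero order_trans by blast
  then have b: "0 \<le> b" using \<open>u \<noteq> 0\<close> by (simp add: zero_le_mult_iff)
  have "cmod (z - lam $ i) * norm w \<le> norm (diag_matrix (\<chi> j. z - lam $ j) *v w)"
    by (rule norm_diag_matrix_ge) (auto simp flip: i)
  also have "\<dots> \<le> spectral_norm (matrix_inv V) * norm (z *s u - C *v u)"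
    unfolding eq by (rule norm_mult_vec_le_spectral_norm)
  also have "\<dots> \<le> spectral_norm (matrix_inv V) * (b * norm u)"
    by (intro mult_left_mono resid spectral_norm_nonneg)
  also have "\<dots> \<le> spectral_norm (matrix_inv V) * (b * (spectral_norm V * norm w))"
    unfolding u by (intro mult_left_mono norm_mult_vec_le_spectral_norm b spectral_norm_nonneg)
  also have "\<dots> = cond_number V * b * norm w"
    by (simp add: cond_number_def)
  finally show ?thesis using \<open>w \<noteq> 0\<close> by auto
qed

section \<open>Inner disks\<close>

lemma pencil_pseudospectrum_mat_mult:
  assumes "u \<noteq> 0" "0 < \<epsilon>" "cmod c * spectral_norm M \<le> \<epsilon>"
    and "A *v u + c *s (M *v u) = z *s (B *v u)"
  shows "z \<in> pencil_pseudospectrum \<epsilon> A B"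
proof -
  have "(A + mat c ** M) *v u = z *s ((B + 0) *v u)"
    using assms(4)
    by (simp add: matrix_vector_mult_add_rdistrib mat_mult_vec flip: matrix_vector_mul_assoc)
  moreover have "spectral_norm (mat c ** M) \<le> \<epsilon>"
    using spectral_norm_mat_mult_le assms(3) by (rule order_trans)
  moreover have "spectral_norm (0 :: complex ^ 'a ^ 'a) \<le> \<epsilon>"
    using assms(2) by simp
  ultimately show ?thesis
    unfolding pencil_pseudospectrum_def using assms(1) by blast
qed

lemma cball_subset_pencil_pseudospectrum:
  assumes "u \<noteq> 0" and eig: "A *v u = l *s (B *v u)" and "B \<noteq> 0" and "0 < \<epsilon>"
    and \<rho>: "\<rho> = (if A = 0 then 1 / spectral_norm B
                else max (1 / spectral_norm B) (cmod l / spectral_norm A))"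
  shows "cball l (\<epsilon> * \<rho>) \<subseteq> pencil_pseudospectrum \<epsilon> A B"
proof
  fix z assume "z \<in> cball l (\<epsilon> * \<rho>)"
  then have z: "cmod (z - l) \<le> \<epsilon> * \<rho>"
    by (simp add: dist_norm norm_minus_commute)
  have B: "0 < spectral_norm B" using \<open>B \<noteq> 0\<close> by (rule spectral_norm_pos)
  show "z \<in> pencil_pseudospectrum \<epsilon> A B"
  \<comment> \<open>Splitting on the value of \<open>\<rho>\<close> puts \<open>A = 0\<close> into
    the same case as a maximum equal to \<open>1 / spectral_norm B\<close>; a multiple of
    \<open>B\<close> serves both.\<close>
  proof (cases "\<rho> = 1 / spectral_norm B")
    case True
    with z B have "cmod (z - l) * spectral_norm B \<le> \<epsilon>"
      by (simp add: field_simps)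
    moreover have "A *v u + (z - l) *s (B *v u) = z *s (B *v u)"
      by (simp add: eig vector_sub_rdistrib)
    ultimately show ?thesis
      by (intro pencil_pseudospectrum_mat_mult[where M = B]) (use assms in auto)
  next
    case False
    then have "A \<noteq> 0" and \<rho>': "\<rho> = cmod l / spectral_norm A"
      unfolding \<rho> by (auto simp: max_def split: if_splits)
    have A: "0 < spectral_norm A" using \<open>A \<noteq> 0\<close> by (rule spectral_norm_pos)
    \<comment> \<open>For \<open>l = 0\<close> the second quotient vanishes and the maximum would be
      \<open>1 / spectral_norm B\<close>; so dividing by \<open>l\<close> is safe.\<close>
    have "l \<noteq> 0"
    proof
      assume "l = 0"
      with False B show False unfolding \<rho> by (simp add: max_def split: if_splits)
    qed
    have "cmod ((z - l) / l) * spectral_norm A \<le> \<epsilon>"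
      using z A \<open>l \<noteq> 0\<close> by (simp add: \<rho>' norm_divide field_simps)
    moreover have "A *v u + ((z - l) / l) *s (A *v u) = z *s (B *v u)"
      using \<open>l \<noteq> 0\<close> by (simp add: eig vec_eq_iff field_simps)
    ultimately show ?thesis
      by (intro pencil_pseudospectrum_mat_mult[where M = A]) (use assms in auto)
  qed
qed

text \<open>The \<open>i\<close>-th column \<open>V *v axis i 1\<close> of \<open>V\<close> is an
  eigenvector of \<open>matrix_inv B ** A\<close>; multiplying by \<open>B\<close> turns this into
  the pencil equation.\<close>

lemma eigenvector_of_diagonalization:
  fixes A B V :: "complex ^ 'n ^ 'n"
  assumes B: "invertible B" and V: "invertible V"
    and C: "matrix_inv B ** A = V ** diag_matrix lam ** matrix_inv V"
  shows "\<exists>u. u \<noteq> 0 \<and> A *v u = lam $ i *s (B *v u)"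
proof (intro exI conjI)
  let ?e = "axis i (1 :: complex)" and ?u = "V *v axis i 1"
  have "matrix_inv V *v ?u \<noteq> 0" by (simp add: matrix_inv_cancel[OF V])
  then show "?u \<noteq> 0" by auto
  have "diag_matrix lam *v ?e = lam $ i *s ?e"
    by (simp add: vec_eq_iff diag_matrix_mult_vec axis_def)
  then have "(matrix_inv B ** A) *v ?u = lam $ i *s ?u"
    by (simp add: C matrix_inv_cancel[OF V] vector_scalar_commute flip: matrix_vector_mul_assoc)
  then have "B *v (matrix_inv B *v (A *v ?u)) = B *v (lam $ i *s ?u)"
    unfolding matrix_vector_mul_assoc[of "matrix_inv B" A] by simp
  then show "A *v ?u = lam $ i *s (B *v ?u)"
    by (simp add: matrix_inv_cancel[OF B] vector_scalar_commute)
qed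

section \<open>Outer disks\<close>

lemma pencil_pseudospectrum_subset_cball:
  assumes B: "invertible B" and V: "invertible V"
    and C: "matrix_inv B ** A = V ** diag_matrix lam ** matrix_inv V"
    and "0 < \<epsilon>" and \<eta>: "\<eta> = \<epsilon> * spectral_norm (matrix_inv B)" "\<eta> < 1"
    and z: "z \<in> pencil_pseudospectrum \<epsilon> A B"
  shows "\<exists>i. cmod (z - lam $ i)
    \<le> cond_number V * (\<eta> * (1 + (\<eta> + spectral_norm (matrix_inv B ** A)) / (1 - \<eta>)))"
proof -
  let ?C = "matrix_inv B ** A"
  from z obtain u dA dB where "u \<noteq> 0" and d: "spectral_norm dA \<le> \<epsilon>" "spectral_norm dB \<le> \<epsilon>"
    and eq: "(A + dA) *v u = z *s ((B + dB) *v u)"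
    unfolding pencil_pseudospectrum_def by auto
  define e f where "e = matrix_inv B *v (dB *v u)" and "f = matrix_inv B *v (dA *v u)"
  have small: "norm (matrix_inv B *v (M *v u)) \<le> \<eta> * norm u" if "spectral_norm M \<le> \<epsilon>" for M
  proof -
    have "norm (matrix_inv B *v (M *v u)) \<le> spectral_norm (matrix_inv B) * norm (M *v u)"
      by (rule norm_mult_vec_le_spectral_norm)
    also have "\<dots> \<le> spectral_norm (matrix_inv B) * (spectral_norm M * norm u)"
      by (intro mult_left_mono norm_mult_vec_le_spectral_norm spectral_norm_nonneg)
    also have "\<dots> \<le> spectral_norm (matrix_inv B) * (\<epsilon> * norm u)"
      by (intro mult_left_mono mult_right_mono that spectral_norm_nonneg) simp
    finally show ?thesis by (simp add: \<eta> mult_ac)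
  qed
  have e: "norm e \<le> \<eta> * norm u" and f: "norm f \<le> \<eta> * norm u"
    unfolding e_def f_def by (intro small d)+
  have "matrix_inv B *v ((A + dA) *v u) = matrix_inv B *v (z *s ((B + dB) *v u))"
    by (simp add: eq)
  then have key: "?C *v u + f = z *s (u + e)"
    by (simp add: e_def f_def matrix_vector_mult_add_rdistrib matrix_vector_right_distrib
        vector_scalar_commute matrix_inv_cancel[OF B] flip: matrix_vector_mul_assoc)
  \<comment> \<open>First an a priori bound on \<open>cmod z\<close>: since
    \<open>\<eta> < 1\<close>, the vector \<open>u + e\<close> keeps at least the fraction
    \<open>1 - \<eta>\<close> of the norm of \<open>u\<close>.\<close>
  have "norm u - norm e \<le> norm (u + e)"
    using norm_diff_ineq .
  with e have "(1 - \<eta>) * norm u \<le> norm (u + e)"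
    by (simp add: algebra_simps)
  then have "cmod z * ((1 - \<eta>) * norm u) \<le> norm (z *s (u + e))"
    unfolding norm_vector_smult by (intro mult_left_mono) auto
  also have "\<dots> \<le> norm (?C *v u) + norm f"
    unfolding key[symmetric] by (rule norm_triangle_ineq)
  also have "\<dots> \<le> (\<eta> + spectral_norm ?C) * norm u"
    using f norm_mult_vec_le_spectral_norm[of ?C u] by (simp add: algebra_simps)
  finally have "(cmod z * (1 - \<eta>)) * norm u \<le> (\<eta> + spectral_norm ?C) * norm u"
    by (simp add: mult_ac)
  then have "cmod z * (1 - \<eta>) \<le> \<eta> + spectral_norm ?C"
    by (rule mult_right_le_imp_le) (simp add: \<open>u \<noteq> 0\<close>)
  then have zle: "cmod z \<le> (\<eta> + spectral_norm ?C) / (1 - \<eta>)"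
    using \<eta>(2) by (simp add: pos_le_divide_eq)
  have \<eta>0: "0 \<le> \<eta>" using \<open>0 < \<epsilon>\<close> by (simp add: \<eta> spectral_norm_nonneg)
  \<comment> \<open>The same identity \<open>key\<close>, rearranged, gives the residual of
    \<open>u\<close>; \<open>zle\<close> then removes \<open>cmod z\<close> from its
    estimate.\<close>
  have "z *s u - ?C *v u = f - z *s e"
    using key by (simp add: vector_add_ldistrib algebra_simps)
  then have "norm (z *s u - ?C *v u) \<le> norm f + cmod z * norm e"
    by (metis norm_triangle_ineq4 norm_vector_smult)
  also have "\<dots> \<le> \<eta> * norm u + cmod z * (\<eta> * norm u)"
    by (intro add_mono f mult_left_mono e) simp
  also have "\<dots> = \<eta> * (1 + cmod z) * norm u"
    by (simp add: algebra_simps)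
  also have "\<dots> \<le> \<eta> * (1 + (\<eta> + spectral_norm ?C) / (1 - \<eta>)) * norm u"
    using zle \<eta>0 by (intro mult_right_mono mult_left_mono) auto
  finally show ?thesis
    by (rule bauer_fike[OF V C \<open>u \<noteq> 0\<close>])
qed

theorem theorem2p20:
  fixes A B V :: "complex ^ 'n ^ 'n"
    and lam :: "complex ^ 'n"
    and \<epsilon> r\<^sub>\<epsilon> :: real
    and r :: "'n \<Rightarrow> real"
  assumes "invertible B"
    and "invertible V"
    and "matrix_inv B ** A = V ** diag_matrix lam ** matrix_inv V"
    and "0 < \<epsilon>" and "\<epsilon> < smallest_singular_value B"
    and "r\<^sub>\<epsilon> = \<epsilon> * cond_number V * spectral_norm (matrix_inv B) *
          (1 + (\<epsilon> * spectral_norm (matrix_inv B) + spectral_norm (matrix_inv B ** A)) /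
               (1 - \<epsilon> * spectral_norm (matrix_inv B)))"
    and "\<And>i. r i = (if A = 0 then 1 / spectral_norm B
                  else max (1 / spectral_norm B) (cmod (lam $ i) / spectral_norm A))"
  shows "(\<Union>i. cball (lam $ i) (\<epsilon> * r i)) \<subseteq> pencil_pseudospectrum \<epsilon> A B \<and>
         pencil_pseudospectrum \<epsilon> A B \<subseteq> (\<Union>i. cball (lam $ i) r\<^sub>\<epsilon>)"
proof -
  let ?\<eta> = "\<epsilon> * spectral_norm (matrix_inv B)"
  \<comment> \<open>\<open>B = 0\<close> would map \<open>matrix_inv B *v 1\<close> to 0 instead of
    the all-ones vector. Nonvanishing makes \<open>1 / spectral_norm B\<close> a true
    quotient.\<close>
  have "B \<noteq> 0"
    using matrix_inv_cancel(1)[OF assms(1), of 1] by auto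
  have "cball (lam $ i) (\<epsilon> * r i) \<subseteq> pencil_pseudospectrum \<epsilon> A B" for i
  proof -
    obtain u where "u \<noteq> 0" "A *v u = lam $ i *s (B *v u)"
      using eigenvector_of_diagonalization[OF assms(1-3)] by blast
    then show ?thesis
      using \<open>B \<noteq> 0\<close> assms(4,7) by (rule cball_subset_pencil_pseudospectrum)
  qed
  moreover have "z \<in> (\<Union>i. cball (lam $ i) r\<^sub>\<epsilon>)" if "z \<in> pencil_pseudospectrum \<epsilon> A B" for z
  proof -
    have "r\<^sub>\<epsilon> = cond_number V
        * (?\<eta> * (1 + (?\<eta> + spectral_norm (matrix_inv B ** A)) / (1 - ?\<eta>)))"
      unfolding assms(6) by (simp only: mult_ac)
    then show ?thesis
      using pencil_pseudospectrum_subset_cball[OF assms(1-4) refl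
          spectral_norm_matrix_inv_less[OF assms(1,4,5)] that]
      by (auto simp: dist_norm norm_minus_commute)
  qed
  ultimately show ?thesis by blast
qed

end
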